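(* Let the infinite sequence $\{(x_k,u_k)\}$ be generated by the method B-STEP-DCA described in the context, let the sequence of penalty parameters $\{c_k\}$ be bounded, and let $\sum_{k=0}^\infty\nu_k<+\infty$. Denote $\rho_k=\|(x_k[c_{k+1}]-x_k,u_k[c_{k+1}]-u_k)\|_2$. Then: 1. $\sum_{k=0}^\infty\alpha_k^2\rho_k^2<+\infty$; 2. $|\Phi_{c_{k+1}}(x_{k+1},u_{k+1})-\Phi_{c_{k+1}}(x_k,u_k)|\to0$ as $k\to\infty$; 3. the sequence $\{\Phi_{c_k}(x_k,u_k)\}$ converges.
   Context: Notation. $T>0$; $|\cdot|$ is the Euclidean norm; $\mathbb N=\{0,1,2,\dots\}$; $\|\cdot\|_s$ is the $L^s$ norm on $[0,T]$, and $\|(x,u)\|_2^2=\int_0^T(|x(t)|^2+|u(t)|^2)\,dt$; $W^{1,s}([0,T];\mathbb R^n)$ is the space of absolutely continuous $x$ with $\dot x\in L^s$, normed by $\|x\|_{1,s}=\|x\|_s+\|\dot x\|_s$. $X=W^{1,\infty}([0,T];\mathbb R^n)\times L^\infty([0,T];\mathbb R^m)$ with norm $\|x\|_{1,\infty}+\|u\|_\infty$; $Y=W^{1,1}([0,T];\mathbb R^n)\times L^1([0,T];\mathbb R^m)$ with norm $\|x\|_{1,1}+\|u\|_1$. $X_0\subseteq X$ is a convex set closed in $X$ with respect to the topology of $Y$. $\partial$ is the convex subdifferential, $\partial_{x,u}$ the one with respect to $(x,u)$. A point $z\in X_0$ is $\varepsilon$-optimal for minimising $f$ over $X_0$ if $f(z)\le\inf_{X_0}f+\varepsilon$.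 Problem $(\mathcal P)$: minimise $J(x,u)=\int_0^TF_0(x(t),u(t),t)\,dt+f_0(x(0),x(T))$ over $(x,u)\in X_0$ subject to $\dot x(t)=F(x(t),u(t),t)$ for a.e. $t$; $f_i(x(0),x(T))\le0$, $i\in\mathcal I=\{1,\dots,\ell_I\}$; $f_j(x(0),x(T))=0$, $j\in\mathcal E=\{\ell_I+1,\dots,\ell_E\}$; $\Xi_s(x(t),u(t),t)\le0$ for a.e. $t$, $s\in\mathcal M=\{1,\dots,\ell_M\}$ (index sets may be empty). Here $F_0=G_0-H_0$, $F=G-H$ ($\mathbb R^n$-valued, components $F_i=G_i-H_i$, $i=1,\dots,n$), $f_i=g_i-h_i$ on $\mathbb R^{2n}$, $\Xi_s=p_s-q_s$, where $G_i,H_i$ ($0\le i\le n$), $p_s,q_s$ are real-valued functions of $(x,u,t)\in\mathbb R^n\times\mathbb R^m\times[0,T]$ convex in $(x,u)$, and $g_i,h_i$ are real-valued convex functions (possibly nonsmooth). Data assumptions. $G_i,H_i$ ($0\le i\le n$), $p_s,q_s$ are Carathéodory (continuous in $(x,u)$ for a.e. $t$, measurable in $t$); for every $(x,u)\in X$ the multifunctions $t\mapsto\partial_{x,u}G_i(x(t),u(t),t)$, and likewise for $H_i,p_s,q_s$, are measurable; for every $R>0$ there is $\gamma_R>0$ such that for a.e. $t$ and all $(x,u)$ with $|x|+|u|\le R$ the absolute values of all these functions at $(x,u,t)$, and the norms of all their subgradients in $(x,u)$ there, are at most $\gamma_R$. Penalty function. $\Phi_c=J+c\varphi$, $\varphi(x,u)=\sum_{i=1}^n\int_0^T|\dot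 x_i(t)-F_i(x(t),u(t),t)|\,dt+\sum_{i\in\mathcal I}\max\{0,f_i(x(0),x(T))\}+\sum_{j\in\mathcal E}|f_j(x(0),x(T))|+\sum_{s\in\mathcal M}\int_0^T\max\{0,\Xi_s(x(t),u(t),t)\}\,dt$. Convex majorants. A collection of subgradients at $(\bar x,\bar u)\in X$ is $V=(V_0,\dots,V_n,W_1,\dots,W_n,v_0,\dots,v_{\ell_E},w_{\ell_I+1},\dots,w_{\ell_E},z_1,\dots,z_{\ell_M})$ with $V_i,W_i,z_s$ measurable on $[0,T]$ and, for a.e. $t$, $V_i(t)\in\partial_{x,u}H_i(\bar x(t),\bar u(t),t)$, $W_i(t)\in\partial_{x,u}G_i(\bar x(t),\bar u(t),t)$, $z_s(t)\in\partial_{x,u}q_s(\bar x(t),\bar u(t),t)$, $v_i\in\partial h_i(\bar x(0),\bar x(T))$, $w_j\in\partial g_j(\bar x(0),\bar x(T))$. With $\Delta(t)=(x(t)-\bar x(t),u(t)-\bar u(t))$, $\Delta_b=(x(0)-\bar x(0),x(T)-\bar x(T))$, put $\Gamma(x,u;\bar x,\bar u;V)=\sum_{i=1}^n\int_0^T\max\{\dot x_i+H_i(x,u,t)-G_i(\bar x,\bar u,t)-\langle W_i,\Delta\rangle,\,-\dot x_i+G_i(x,u,t)-H_i(\bar x,\bar u,t)-\langle V_i,\Delta\rangle\}\,dt+\sum_{i\in\mathcal I}\max\{0,g_i(x(0),x(T))-h_i(\bar x(0),\bar x(T))-\langle v_i,\Delta_b\rangle\}+\sum_{j\in\mathcal E}\max\{g_j(x(0),x(T))-h_j(\bar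 x(0),\bar x(T))-\langle v_j,\Delta_b\rangle,\,h_j(x(0),x(T))-g_j(\bar x(0),\bar x(T))-\langle w_j,\Delta_b\rangle\}+\sum_{s\in\mathcal M}\int_0^T\max\{0,p_s(x,u,t)-q_s(\bar x,\bar u,t)-\langle z_s,\Delta\rangle\}\,dt$ (functions under integrals evaluated at $t$), $\omega(x,u;V)=\int_0^T(G_0(x(t),u(t),t)-\langle V_0(t),(x(t),u(t))\rangle)\,dt+g_0(x(0),x(T))-\langle v_0,(x(0),x(T))\rangle$, and $Q_c(x,u;\bar x,\bar u;V)=\omega(x,u;V)+c\,\Gamma(x,u;\bar x,\bar u;V)$. Method B-STEP-DCA. Choose $(x_0,u_0)\in X_0$, $c_0>0$, $\eta_1,\eta_2,\zeta,\sigma\in(0,1)$, $\varepsilon_\varphi,\varepsilon_{feas}>0$, $\{\varepsilon_k\}\subset(0,\infty)$. For iteration $k=0,1,\dots$: pick a collection of subgradients $V_k$ at $(x_k,u_k)$; write $\Gamma_k(\cdot)=\Gamma(\cdot;x_k,u_k;V_k)$, $\omega_k(\cdot)=\omega(\cdot;V_k)$, $Q_{c,k}=\omega_k+c\Gamma_k$; $(x_k[c],u_k[c])$ denotes a computed $\varepsilon_k$-optimal solution of $\min_{X_0}Q_{c,k}$. Step 1: $c_+=c_k$; compute $(x_k[c_+],u_k[c_+])$; if $\Gamma_k(x_k[c_+],u_k[c_+])\le\varepsilon_\varphi$ go to Step 4, else to Step 2. Step 2: compute an $\varepsilon_k$-optimal solution $(\widehat x_k,\widehat u_k)$ of $\min_{X_0}\Gamma_k$.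 If $\Gamma_k(\widehat x_k,\widehat u_k)<\Gamma_k(x_k,u_k)$ go to Step 3. Otherwise, while $\Gamma_k(x_k[c_+],u_k[c_+])\le\Gamma_k(x_k,u_k)+\varepsilon_{feas}$ fails, increase $c_+$ and recompute $(x_k[c_+],u_k[c_+])$; then go to Step 4. Step 3: while $\Gamma_k(x_k[c_+],u_k[c_+])-\Gamma_k(x_k,u_k)\le\eta_1(\Gamma_k(\widehat x_k,\widehat u_k)-\Gamma_k(x_k,u_k))$ fails, increase $c_+$ and recompute; then go to Step 4. Step 4: put $c_{k+1}=c_+$; while $Q_{c_{k+1},k}(x_k[c_{k+1}],u_k[c_{k+1}])-Q_{c_{k+1},k}(x_k,u_k)\le c_{k+1}\eta_2(\Gamma_k(x_k[c_{k+1}],u_k[c_{k+1}])-\Gamma_k(x_k,u_k))$ fails, increase $c_{k+1}$ and recompute. Step 5: with $d_k=(x_k[c_{k+1}]-x_k,u_k[c_{k+1}]-u_k)$, choose $\nu_k>0$, $\overline\alpha_k\ge0$, find the smallest $j_k\in\mathbb N$ such that, for $\alpha_k=\zeta^{j_k}\overline\alpha_k$, $\Phi_{c_{k+1}}((x_k[c_{k+1}],u_k[c_{k+1}])+\alpha_kd_k)-\Phi_{c_{k+1}}(x_k[c_{k+1}],u_k[c_{k+1}])\le-\sigma\alpha_k^2\|d_k\|_2^2+\nu_k$; set $(x_{k+1},u_{k+1})=(x_k[c_{k+1}],u_k[c_{k+1}])+\alpha_kd_k$. (No stopping criterion is applied, so the sequence is infinite.) Standing assumptions on the method. All computed points $(x_k[c],u_k[c])$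 satisfy $Q_{c,k}(x_k[c],u_k[c])\le Q_{c,k}(x_k,u_k)$. The trial step $\overline\alpha_k$ is such that $(x_k[c_{k+1}],u_k[c_{k+1}])+\zeta^j\overline\alpha_kd_k\in X_0$ for all $j\in\mathbb N$. $\Phi_{c_0}$ is bounded below on $X_0$. There is $\varkappa>0$ such that whenever $c_+$ or $c_{k+1}$ is increased in Steps 2, 3, 4, it is increased by at least $\varkappa$. *)

theory Defs
  imports "HOL-Analysis.Analysis"
begin

section \<open>Function spaces on a compact interval\<close>

abbreviation time_measure :: "real \<Rightarrow> real measure" where
  "time_measure T \<equiv> lebesgue_on {0..T}"

definition abs_cont_on :: "real \<Rightarrow> real \<Rightarrow> (real \<Rightarrow> 'a::real_normed_vector) \<Rightarrow> bool" where
  "abs_cont_on a b x \<longleftrightarrow>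
     (\<forall>\<epsilon>>0. \<exists>\<delta>>0. \<forall>(N::nat) l r.
        (\<forall>i<N. a \<le> l i \<and> l i \<le> r i \<and> r i \<le> b) \<and>
        disjoint_family_on (\<lambda>i. {l i<..<r i}) {..<N} \<and>
        (\<Sum>i<N. r i - l i) < \<delta> \<longrightarrow>
        (\<Sum>i<N. norm (x (r i) - x (l i))) < \<epsilon>)"

text \<open>The almost everywhere derivative of an absolutely continuous function. On the null set of
  points of non-differentiability its value is unspecified.\<close>
definition wderiv :: "real \<Rightarrow> (real \<Rightarrow> 'a::real_normed_vector) \<Rightarrow> real \<Rightarrow> 'a" where
  "wderiv T x t = vector_derivative x (at t within {0..T})"

definition Linf :: "real \<Rightarrow> (real \<Rightarrow> 'a::euclidean_space) set" where
  "Linf T = {f \<in> borel_measurable (time_measure T).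
               \<exists>C. AE t in time_measure T. norm (f t) \<le> C}"

definition W1inf :: "real \<Rightarrow> (real \<Rightarrow> 'a::euclidean_space) set" where
  "W1inf T = {x. abs_cont_on 0 T x \<and> wderiv T x \<in> Linf T}"

text \<open>Elements of the function spaces are represented by functions on the whole real line, of which
  only the restriction to $[0,T]$ matters.\<close>
type_synonym ('n, 'm) traj = "(real \<Rightarrow> real ^ 'n) \<times> (real \<Rightarrow> real ^ 'm)"

definition space_X :: "real \<Rightarrow> ('n::finite, 'm::finite) traj set" where
  "space_X T = W1inf T \<times> Linf T"

definition at_time :: "('n::finite, 'm::finite) traj \<Rightarrow> real \<Rightarrow> (real ^ 'n) \<times> (real ^ 'm)" where
  "at_time z t = (fst z t, snd z t)"

definition at_ends :: "real \<Rightarrow> ('n::finite, 'm::finite) traj \<Rightarrow> (real ^ 'n) \<times> (real ^ 'n)" where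
  "at_ends T z = (fst z 0, fst z T)"

definition traj_diff ::
    "('n::finite, 'm::finite) traj \<Rightarrow> ('n, 'm) traj \<Rightarrow> ('n, 'm) traj" where
  "traj_diff z w = ((\<lambda>t. fst z t - fst w t), (\<lambda>t. snd z t - snd w t))"

definition traj_step ::
    "('n::finite, 'm::finite) traj \<Rightarrow> real \<Rightarrow> ('n, 'm) traj \<Rightarrow> ('n, 'm) traj" where
  "traj_step z a d = ((\<lambda>t. fst z t + a *\<^sub>R fst d t), (\<lambda>t. snd z t + a *\<^sub>R snd d t))"

definition traj_convex :: "('n::finite, 'm::finite) traj set \<Rightarrow> bool" where
  "traj_convex S \<longleftrightarrow>
     (\<forall>z\<in>S. \<forall>w\<in>S. \<forall>a\<in>{0..1}.
        ((\<lambda>t. (1 - a) *\<^sub>R fst z t + a *\<^sub>R fst w t),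
         (\<lambda>t. (1 - a) *\<^sub>R snd z t + a *\<^sub>R snd w t)) \<in> S)"

definition norm_Y :: "real \<Rightarrow> ('n::finite, 'm::finite) traj \<Rightarrow> real" where
  "norm_Y T z =
     (\<integral>t. norm (fst z t) \<partial>time_measure T) + (\<integral>t. norm (wderiv T (fst z) t) \<partial>time_measure T)
     + (\<integral>t. norm (snd z t) \<partial>time_measure T)"

definition norm_L2 :: "real \<Rightarrow> ('n::finite, 'm::finite) traj \<Rightarrow> real" where
  "norm_L2 T z = sqrt (\<integral>t. (norm (fst z t))\<^sup>2 + (norm (snd z t))\<^sup>2 \<partial>time_measure T)"

text \<open>Sets of functions stand for sets of equivalence classes: since \<^term>\<open>norm_Y T\<close> is only
  a seminorm on functions, a set that is closed in this sense is automatically saturated with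
  respect to equality of states on $[0,T]$ and of controls almost everywhere on $[0,T]$.\<close>
definition closed_in_X_wrt_Y :: "real \<Rightarrow> ('n::finite, 'm::finite) traj set \<Rightarrow> bool" where
  "closed_in_X_wrt_Y T S \<longleftrightarrow>
     (\<forall>z\<in>space_X T. (\<forall>\<epsilon>>0. \<exists>w\<in>S. norm_Y T (traj_diff w z) < \<epsilon>) \<longrightarrow> z \<in> S)"


section \<open>Convex subdifferential, Caratheodory functions, measurable multifunctions\<close>

definition subdifferential :: "('a::real_inner \<Rightarrow> real) \<Rightarrow> 'a \<Rightarrow> 'a set" where
  "subdifferential f z = {v. \<forall>y. f z + v \<bullet> (y - z) \<le> f y}"

definition caratheodory :: "real \<Rightarrow> ('a::euclidean_space \<Rightarrow> real \<Rightarrow> real) \<Rightarrow> bool" where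
  "caratheodory T f \<longleftrightarrow>
     (AE t in time_measure T. continuous_on UNIV (\<lambda>z. f z t)) \<and>
     (\<forall>z. (\<lambda>t. f z t) \<in> borel_measurable (time_measure T))"

definition measurable_multifunction ::
    "'t measure \<Rightarrow> ('t \<Rightarrow> 'a::topological_space set) \<Rightarrow> bool" where
  "measurable_multifunction M \<Psi> \<longleftrightarrow> (\<forall>U. open U \<longrightarrow> {t \<in> space M. \<Psi> t \<inter> U \<noteq> {}} \<in> sets M)"

definition eps_optimal :: "real \<Rightarrow> 'a set \<Rightarrow> ('a \<Rightarrow> real) \<Rightarrow> 'a \<Rightarrow> bool" where
  "eps_optimal \<epsilon> S f z \<longleftrightarrow> z \<in> S \<and> ereal (f z) \<le> (INF w\<in>S. ereal (f w)) + ereal \<epsilon>"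


section \<open>The DC optimal control problem\<close>

text \<open>The components
  $G_i$, $H_i$ ($1 \le i \le n$) are indexed by the type variable \<open>'n\<close>, separately
  from $G_0$, $H_0$, which are \<open>cost_G\<close>, \<open>cost_H\<close>. The functions
  $g_i$, $h_i$ of the end points are \<open>end_g P i\<close>, \<open>end_h P i\<close> with
  $0 \le i \le \ell_E$, where index $0$ belongs to the cost.\<close>
record ('n, 'm) dc_ocp =
  horizon :: real
  cost_G :: "(real ^ 'n) \<times> (real ^ 'm) \<Rightarrow> real \<Rightarrow> real"
  cost_H :: "(real ^ 'n) \<times> (real ^ 'm) \<Rightarrow> real \<Rightarrow> real"
  dyn_G :: "(real ^ 'n) \<times> (real ^ 'm) \<Rightarrow> real \<Rightarrow> real ^ 'n"
  dyn_H :: "(real ^ 'n) \<times> (real ^ 'm) \<Rightarrow> real \<Rightarrow> real ^ 'n"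
  end_g :: "nat \<Rightarrow> (real ^ 'n) \<times> (real ^ 'n) \<Rightarrow> real"
  end_h :: "nat \<Rightarrow> (real ^ 'n) \<times> (real ^ 'n) \<Rightarrow> real"
  path_p :: "nat \<Rightarrow> (real ^ 'n) \<times> (real ^ 'm) \<Rightarrow> real \<Rightarrow> real"
  path_q :: "nat \<Rightarrow> (real ^ 'n) \<times> (real ^ 'm) \<Rightarrow> real \<Rightarrow> real"
  ell_I :: nat
  ell_E :: nat
  ell_M :: nat
  adm :: "('n, 'm) traj set"

abbreviation idx_I :: "('n::finite, 'm::finite) dc_ocp \<Rightarrow> nat set" where
  "idx_I P \<equiv> {1..ell_I P}"

abbreviation idx_E :: "('n::finite, 'm::finite) dc_ocp \<Rightarrow> nat set" where
  "idx_E P \<equiv> {ell_I P + 1..ell_E P}"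

abbreviation idx_M :: "('n::finite, 'm::finite) dc_ocp \<Rightarrow> nat set" where
  "idx_M P \<equiv> {1..ell_M P}"

definition running_functions ::
    "('n::finite, 'm::finite) dc_ocp \<Rightarrow> ((real ^ 'n) \<times> (real ^ 'm) \<Rightarrow> real \<Rightarrow> real) set" where
  "running_functions P =
     {cost_G P, cost_H P}
     \<union> range (\<lambda>i z t. dyn_G P z t $ i) \<union> range (\<lambda>i z t. dyn_H P z t $ i)
     \<union> path_p P ` idx_M P \<union> path_q P ` idx_M P"

locale dc_ocp_data =
  fixes P :: "('n::finite, 'm::finite) dc_ocp"
  assumes horizon_pos: "horizon P > 0"
    and ell_I_le_ell_E: "ell_I P \<le> ell_E P"
    and adm_subset: "adm P \<subseteq> space_X (horizon P)"
    and adm_convex: "traj_convex (adm P)"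
    and adm_closed: "closed_in_X_wrt_Y (horizon P) (adm P)"
    and end_convex:
      "\<And>i. i \<le> ell_E P \<Longrightarrow> convex_on UNIV (end_g P i) \<and> convex_on UNIV (end_h P i)"
    and running_convex:
      "\<And>f t. f \<in> running_functions P \<Longrightarrow> t \<in> {0..horizon P} \<Longrightarrow> convex_on UNIV (\<lambda>z. f z t)"
    and running_caratheodory:
      "\<And>f. f \<in> running_functions P \<Longrightarrow> caratheodory (horizon P) f"
    and running_multifunction:
      "\<And>f z. f \<in> running_functions P \<Longrightarrow> z \<in> space_X (horizon P) \<Longrightarrow>
         measurable_multifunction (time_measure (horizon P))
           (\<lambda>t. subdifferential (\<lambda>y. f y t) (at_time z t))"
    and running_bound:
      "\<And>R. R > 0 \<Longrightarrow> \<exists>\<gamma>>0. AE t in time_measure (horizon P).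
         \<forall>x u. norm x + norm u \<le> R \<longrightarrow>
           (\<forall>f\<in>running_functions P. \<bar>f (x, u) t\<bar> \<le> \<gamma> \<and>
             (\<forall>v\<in>subdifferential (\<lambda>y. f y t) (x, u). norm v \<le> \<gamma>))"

definition cost_J :: "('n::finite, 'm::finite) dc_ocp \<Rightarrow> ('n, 'm) traj \<Rightarrow> real" where
  "cost_J P z =
     (\<integral>t. cost_G P (at_time z t) t - cost_H P (at_time z t) t \<partial>time_measure (horizon P))
     + (end_g P 0 (at_ends (horizon P) z) - end_h P 0 (at_ends (horizon P) z))"

definition penalty_term :: "('n::finite, 'm::finite) dc_ocp \<Rightarrow> ('n, 'm) traj \<Rightarrow> real" where
  "penalty_term P z =
     (let b = at_ends (horizon P) z in
      (\<Sum>i\<in>UNIV. \<integral>t. \<bar>wderiv (horizon P) (fst z) t $ i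
           - (dyn_G P (at_time z t) t $ i - dyn_H P (at_time z t) t $ i)\<bar>
         \<partial>time_measure (horizon P))
      + (\<Sum>i\<in>idx_I P. max 0 (end_g P i b - end_h P i b))
      + (\<Sum>j\<in>idx_E P. \<bar>end_g P j b - end_h P j b\<bar>)
      + (\<Sum>s\<in>idx_M P. \<integral>t. max 0 (path_p P s (at_time z t) t - path_q P s (at_time z t) t)
         \<partial>time_measure (horizon P)))"

definition penalty_fun ::
    "('n::finite, 'm::finite) dc_ocp \<Rightarrow> real \<Rightarrow> ('n, 'm) traj \<Rightarrow> real" where
  "penalty_fun P c z = cost_J P z + c * penalty_term P z"


section \<open>Collections of subgradients and convex majorants\<close>

record ('n, 'm) subgrads =
  sg_V0 :: "real \<Rightarrow> (real ^ 'n) \<times> (real ^ 'm)"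
  sg_V :: "'n \<Rightarrow> real \<Rightarrow> (real ^ 'n) \<times> (real ^ 'm)"
  sg_W :: "'n \<Rightarrow> real \<Rightarrow> (real ^ 'n) \<times> (real ^ 'm)"
  sg_v :: "nat \<Rightarrow> (real ^ 'n) \<times> (real ^ 'n)"
  sg_w :: "nat \<Rightarrow> (real ^ 'n) \<times> (real ^ 'n)"
  sg_z :: "nat \<Rightarrow> real \<Rightarrow> (real ^ 'n) \<times> (real ^ 'm)"

definition measurable_subgradient ::
    "real \<Rightarrow> ('a::euclidean_space \<Rightarrow> real \<Rightarrow> real) \<Rightarrow> (real \<Rightarrow> 'a) \<Rightarrow> (real \<Rightarrow> 'a) \<Rightarrow> bool" where
  "measurable_subgradient T f y S \<longleftrightarrow>
     S \<in> borel_measurable (time_measure T) \<and>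
     (AE t in time_measure T. S t \<in> subdifferential (\<lambda>a. f a t) (y t))"

definition subgradients_at ::
    "('n::finite, 'm::finite) dc_ocp \<Rightarrow> ('n, 'm) traj \<Rightarrow> ('n, 'm) subgrads \<Rightarrow> bool" where
  "subgradients_at P zb S \<longleftrightarrow>
     (let T = horizon P; y = at_time zb; b = at_ends T zb in
      measurable_subgradient T (cost_H P) y (sg_V0 S) \<and>
      (\<forall>i. measurable_subgradient T (\<lambda>a t. dyn_H P a t $ i) y (sg_V S i)) \<and>
      (\<forall>i. measurable_subgradient T (\<lambda>a t. dyn_G P a t $ i) y (sg_W S i)) \<and>
      (\<forall>s\<in>idx_M P. measurable_subgradient T (path_q P s) y (sg_z S s)) \<and>
      (\<forall>i\<in>{0..ell_E P}. sg_v S i \<in> subdifferential (end_h P i) b) \<and>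
      (\<forall>j\<in>idx_E P. sg_w S j \<in> subdifferential (end_g P j) b))"

definition Gamma_maj ::
    "('n::finite, 'm::finite) dc_ocp \<Rightarrow> ('n, 'm) traj \<Rightarrow> ('n, 'm) subgrads
       \<Rightarrow> ('n, 'm) traj \<Rightarrow> real" where
  "Gamma_maj P zb S z =
     (let T = horizon P; b = at_ends T z; bb = at_ends T zb;
          \<Delta> = (\<lambda>t. at_time z t - at_time zb t); \<Delta>b = b - bb in
      (\<Sum>i\<in>UNIV. \<integral>t. max
           (wderiv T (fst z) t $ i + dyn_H P (at_time z t) t $ i - dyn_G P (at_time zb t) t $ i
              - sg_W S i t \<bullet> \<Delta> t)
           (- wderiv T (fst z) t $ i + dyn_G P (at_time z t) t $ i - dyn_H P (at_time zb t) t $ i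
              - sg_V S i t \<bullet> \<Delta> t)
         \<partial>time_measure T)
      + (\<Sum>i\<in>idx_I P. max 0 (end_g P i b - end_h P i bb - sg_v S i \<bullet> \<Delta>b))
      + (\<Sum>j\<in>idx_E P. max
           (end_g P j b - end_h P j bb - sg_v S j \<bullet> \<Delta>b)
           (end_h P j b - end_g P j bb - sg_w S j \<bullet> \<Delta>b))
      + (\<Sum>s\<in>idx_M P. \<integral>t. max 0
           (path_p P s (at_time z t) t - path_q P s (at_time zb t) t - sg_z S s t \<bullet> \<Delta> t)
         \<partial>time_measure T))"

definition omega_maj ::
    "('n::finite, 'm::finite) dc_ocp \<Rightarrow> ('n, 'm) subgrads \<Rightarrow> ('n, 'm) traj \<Rightarrow> real" where
  "omega_maj P S z =
     (\<integral>t. cost_G P (at_time z t) t - sg_V0 S t \<bullet> at_time z t \<partial>time_measure (horizon P))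
     + end_g P 0 (at_ends (horizon P) z) - sg_v S 0 \<bullet> at_ends (horizon P) z"

definition Q_maj ::
    "('n::finite, 'm::finite) dc_ocp \<Rightarrow> real \<Rightarrow> ('n, 'm) traj \<Rightarrow> ('n, 'm) subgrads
       \<Rightarrow> ('n, 'm) traj \<Rightarrow> real" where
  "Q_maj P c zb S z = omega_maj P S z + c * Gamma_maj P zb S z"


section \<open>One iteration of the method\<close>

text \<open>\<open>increase_until \<kappa> comp good c c'\<close> says that the loop
  ``while \<open>good\<close> fails, increase the parameter and recompute the point'' started at
  \<open>c\<close> terminates at \<open>c'\<close>. Each increase is by at least \<open>\<kappa>\<close>, and
  \<open>comp\<close> holds for every newly visited parameter.\<close>
inductive increase_until ::
    "real \<Rightarrow> (real \<Rightarrow> bool) \<Rightarrow> (real \<Rightarrow> bool) \<Rightarrow> real \<Rightarrow> real \<Rightarrow> bool"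
  for \<kappa> :: real and comp good :: "real \<Rightarrow> bool" where
  stop: "good c \<Longrightarrow> increase_until \<kappa> comp good c c"
| increase: "\<lbrakk>\<not> good c; c + \<kappa> \<le> c1; comp c1; increase_until \<kappa> comp good c1 c2\<rbrakk>
    \<Longrightarrow> increase_until \<kappa> comp good c c2"

text \<open>In the following, \<open>zk\<close> is the current iterate, \<open>S\<close> the collection of
  subgradients chosen at it, and \<open>sol c\<close> the point computed for the penalty parameter
  \<open>c\<close>; only the values of \<open>sol\<close> at parameters visited by the method are constrained.\<close>

definition computed_point ::
    "('n::finite, 'm::finite) dc_ocp \<Rightarrow> real \<Rightarrow> ('n, 'm) traj \<Rightarrow> ('n, 'm) subgrads
       \<Rightarrow> (real \<Rightarrow> ('n, 'm) traj) \<Rightarrow> real \<Rightarrow> bool" where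
  "computed_point P \<epsilon> zk S sol c \<longleftrightarrow>
     eps_optimal \<epsilon> (adm P) (Q_maj P c zk S) (sol c) \<and>
     Q_maj P c zk S (sol c) \<le> Q_maj P c zk S zk"

definition steps_1_to_3 ::
    "('n::finite, 'm::finite) dc_ocp \<Rightarrow> real \<Rightarrow> real \<Rightarrow> real \<Rightarrow> real \<Rightarrow> real
       \<Rightarrow> ('n, 'm) traj \<Rightarrow> ('n, 'm) subgrads \<Rightarrow> (real \<Rightarrow> ('n, 'm) traj) \<Rightarrow> ('n, 'm) traj
       \<Rightarrow> real \<Rightarrow> real \<Rightarrow> bool" where
  "steps_1_to_3 P \<kappa> \<eta>1 \<epsilon>\<phi> \<epsilon>feas \<epsilon> zk S sol zhat ck cplus \<longleftrightarrow>
     (let \<Gamma> = Gamma_maj P zk S; comp = computed_point P \<epsilon> zk S sol in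
      comp ck \<and>
      (if \<Gamma> (sol ck) \<le> \<epsilon>\<phi> then cplus = ck
       else eps_optimal \<epsilon> (adm P) \<Gamma> zhat \<and>
         (if \<Gamma> zhat < \<Gamma> zk
          then increase_until \<kappa> comp
                 (\<lambda>c. \<Gamma> (sol c) - \<Gamma> zk \<le> \<eta>1 * (\<Gamma> zhat - \<Gamma> zk)) ck cplus
          else increase_until \<kappa> comp
                 (\<lambda>c. \<Gamma> (sol c) \<le> \<Gamma> zk + \<epsilon>feas) ck cplus)))"

definition step_4 ::
    "('n::finite, 'm::finite) dc_ocp \<Rightarrow> real \<Rightarrow> real \<Rightarrow> real
       \<Rightarrow> ('n, 'm) traj \<Rightarrow> ('n, 'm) subgrads \<Rightarrow> (real \<Rightarrow> ('n, 'm) traj)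
       \<Rightarrow> real \<Rightarrow> real \<Rightarrow> bool" where
  "step_4 P \<kappa> \<eta>2 \<epsilon> zk S sol cplus cnext \<longleftrightarrow>
     increase_until \<kappa> (computed_point P \<epsilon> zk S sol)
       (\<lambda>c. Q_maj P c zk S (sol c) - Q_maj P c zk S zk
          \<le> c * \<eta>2 * (Gamma_maj P zk S (sol c) - Gamma_maj P zk S zk)) cplus cnext"

definition line_search_accepts ::
    "('n::finite, 'm::finite) dc_ocp \<Rightarrow> real \<Rightarrow> real \<Rightarrow> real
       \<Rightarrow> ('n, 'm) traj \<Rightarrow> ('n, 'm) traj \<Rightarrow> real \<Rightarrow> bool" where
  "line_search_accepts P \<sigma> \<nu> c w d a \<longleftrightarrow>
     penalty_fun P c (traj_step w a d) - penalty_fun P c w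
       \<le> - \<sigma> * a\<^sup>2 * (norm_L2 (horizon P) d)\<^sup>2 + \<nu>"

text \<open>Here \<open>w\<close> is the computed point for the final penalty parameter \<open>c\<close> of the
  iteration. The condition on \<^term>\<open>adm P\<close> is the requirement on the trial step \<open>abar\<close>.\<close>
definition step_5 ::
    "('n::finite, 'm::finite) dc_ocp \<Rightarrow> real \<Rightarrow> real \<Rightarrow> real \<Rightarrow> real \<Rightarrow> nat \<Rightarrow> real
       \<Rightarrow> ('n, 'm) traj \<Rightarrow> ('n, 'm) traj \<Rightarrow> ('n, 'm) traj \<Rightarrow> bool" where
  "step_5 P \<zeta> \<sigma> \<nu> abar j c zk w znext \<longleftrightarrow>
     (let d = traj_diff w zk in
      0 < \<nu> \<and> 0 \<le> abar \<and>
      (\<forall>i. traj_step w (\<zeta> ^ i * abar) d \<in> adm P) \<and>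
      line_search_accepts P \<sigma> \<nu> c w d (\<zeta> ^ j * abar) \<and>
      (\<forall>i<j. \<not> line_search_accepts P \<sigma> \<nu> c w d (\<zeta> ^ i * abar)) \<and>
      znext = traj_step w (\<zeta> ^ j * abar) d)"

end

theory Submission
  imports Defs
begin

text \<open>Replacing the concave parts by their linearizations gives, for every \<open>c \<ge> 0\<close>,
  $\Phi_c(w) - \Phi_c(z_k) \le Q_{c,k}(w) - Q_{c,k}(z_k)$, where the right-hand side is nonpositive
  at the computed point; with the line search this yields
  $\Phi_{c_{k+1}}(z_{k+1}) \le \Phi_{c_{k+1}}(z_k) - \sigma\alpha_k^2\rho_k^2 + \nu_k$. Every change of the
  penalty parameter is at least \<open>\<kappa>\<close>, so a bounded sequence of parameters is eventually
  constant, and since $\Phi_c \ge \Phi_{c_0}$ for $c \ge c_0$ the inequality telescopes.\<close>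

section \<open>Continuity of the states and measurability of superpositions\<close>

lemma abs_cont_on_imp_continuous_on:
  assumes "abs_cont_on a b x"
  shows "continuous_on {a..b} x"
  unfolding continuous_on_iff
proof (intro ballI allI impI)
  fix t and e :: real
  assume t: "t \<in> {a..b}" and e: "0 < e"
  obtain d where d: "d > 0" and
    H: "\<forall>(N::nat) l r. (\<forall>i<N. a \<le> l i \<and> l i \<le> r i \<and> r i \<le> b) \<and>
        disjoint_family_on (\<lambda>i. {l i<..<r i}) {..<N} \<and>
        (\<Sum>i<N. r i - l i) < d \<longrightarrow> (\<Sum>i<N. norm (x (r i) - x (l i))) < e"
    using assms[unfolded abs_cont_on_def, rule_format, OF e] by (elim exE conjE)
  \<comment> \<open>A family consisting of one interval (\<open>N = 1\<close>) already gives uniform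
    continuity.\<close>
  have *: "norm (x r - x l) < e" if "a \<le> l" "l \<le> r" "r \<le> b" "r - l < d" for l r
    using H[rule_format, of 1 "\<lambda>_. l" "\<lambda>_. r"] that by (simp add: disjoint_family_on_def)
  show "\<exists>d>0. \<forall>s\<in>{a..b}. dist s t < d \<longrightarrow> dist (x s) (x t) < e"
  proof (intro exI[of _ d] conjI ballI impI)
    fix s assume s: "s \<in> {a..b}" and st: "dist s t < d"
    show "dist (x s) (x t) < e"
    proof (cases "s \<le> t")
      case True
      then show ?thesis
        using *[of s t] s t st by (simp add: dist_norm norm_minus_commute)
    next
      case False
      then show ?thesis
        using *[of t s] s t st by (simp add: dist_norm)
    qed
  qed (rule d)
qed

text \<open>Approximate \<open>y\<close> pointwise by simple functions \<open>F i\<close>. Composing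
  with \<open>F i\<close> pastes together finitely many measurable functions \<open>f z\<close>, and
  continuity in the first argument carries measurability to the limit.\<close>

lemma borel_measurable_superposition:
  fixes f :: "'b::{metric_space, second_countable_topology} \<Rightarrow> 'a \<Rightarrow> 'c::metric_space"
  assumes cont: "\<And>t. t \<in> space M \<Longrightarrow> continuous_on UNIV (\<lambda>z. f z t)"
    and meas: "\<And>z. (\<lambda>t. f z t) \<in> borel_measurable M"
    and y: "y \<in> borel_measurable M"
  shows "(\<lambda>t. f (y t) t) \<in> borel_measurable M"
proof -
  obtain F where F: "\<And>i. simple_function M (F i)"
    and lim: "\<And>t. t \<in> space M \<Longrightarrow> (\<lambda>i. F i t) \<longlonglongrightarrow> y t"
    \<comment> \<open>The point \<open>undefined\<close> is arbitrary: it is the reference point of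
      a domination estimate that is discarded here.\<close>
    using borel_measurable_implies_sequence_metric[OF y, of undefined] by blast
  show ?thesis
  proof (rule borel_measurable_LIMSEQ_metric)
    fix i
    show "(\<lambda>t. f (F i t) t) \<in> borel_measurable M"
    proof (rule measurable_compose_countable'[where f = f and g = "F i" and I = "F i ` space M"])
      show "countable (F i ` space M)"
        using F[of i] by (simp add: simple_function_def countable_finite)
      show "F i \<in> measurable M (count_space (F i ` space M))"
        using F[of i] by (auto simp: simple_function_def intro!: measurable_count_space_eq2[THEN iffD2])
    qed (rule meas)
  next
    fix t assume t: "t \<in> space M"
    have "isCont (\<lambda>z. f z t) (y t)"
      using cont[OF t] by (simp add: continuous_on_eq_continuous_at)
    then show "(\<lambda>i. f (F i t) t) \<longlonglongrightarrow> f (y t) t"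
      using lim[OF t] by (rule isCont_tendsto_compose)
  qed
qed


section \<open>Essentially bounded functions\<close>

lemma Linf_I:
  assumes "f \<in> borel_measurable (time_measure T)"
    and "AE t in time_measure T. norm (f t) \<le> C"
  shows "f \<in> Linf T"
  using assms unfolding Linf_def by blast

lemma Linf_E:
  assumes "f \<in> Linf T"
  obtains C where "f \<in> borel_measurable (time_measure T)"
    and "AE t in time_measure T. norm (f t) \<le> C"
  using assms unfolding Linf_def by blast

text \<open>Common pattern of the closure rules below: an operation that preserves measurability and
  maps norm bounds \<open>A\<close>, \<open>B\<close> to a bound \<open>K A B\<close> acts on
  essentially bounded functions. The measurability premise is an implication so that it can be
  discharged from the measurability of \<open>f\<close> and \<open>g\<close>.\<close>

lemma Linf_combine:
  assumes f: "f \<in> Linf T" and g: "g \<in> Linf T"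
    and meas: "\<lbrakk>f \<in> borel_measurable (time_measure T); g \<in> borel_measurable (time_measure T)\<rbrakk>
      \<Longrightarrow> (\<lambda>t. F (f t) (g t)) \<in> borel_measurable (time_measure T)"
    and bound: "\<And>a b A B. norm a \<le> A \<Longrightarrow> norm b \<le> B \<Longrightarrow> norm (F a b) \<le> K A B"
  shows "(\<lambda>t. F (f t) (g t)) \<in> Linf T"
proof -
  from f obtain A where A: "f \<in> borel_measurable (time_measure T)"
    "AE t in time_measure T. norm (f t) \<le> A" by (rule Linf_E)
  from g obtain B where B: "g \<in> borel_measurable (time_measure T)"
    "AE t in time_measure T. norm (g t) \<le> B" by (rule Linf_E)
  have "AE t in time_measure T. norm (F (f t) (g t)) \<le> K A B"
    using A(2) B(2) by eventually_elim (rule bound)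
  with meas[OF A(1) B(1)] show ?thesis by (rule Linf_I)
qed

lemma Linf_add:
  fixes f g :: "real \<Rightarrow> 'a::euclidean_space"
  shows "f \<in> Linf T \<Longrightarrow> g \<in> Linf T \<Longrightarrow> (\<lambda>t. f t + g t) \<in> Linf T"
proof (erule Linf_combine[where K = "(+)"], assumption)
  show "norm (a + b) \<le> A + B" if "norm a \<le> A" "norm b \<le> B" for a b :: 'a and A B
    using norm_triangle_ineq[of a b] that by linarith
qed measurable

lemma Linf_diff:
  fixes f g :: "real \<Rightarrow> 'a::euclidean_space"
  shows "f \<in> Linf T \<Longrightarrow> g \<in> Linf T \<Longrightarrow> (\<lambda>t. f t - g t) \<in> Linf T"
proof (erule Linf_combine[where K = "(+)"], assumption)
  show "norm (a - b) \<le> A + B" if "norm a \<le> A" "norm b \<le> B" for a b :: 'a and A B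
    using norm_triangle_ineq4[of a b] that by linarith
qed measurable

lemma Linf_Pair:
  fixes f :: "real \<Rightarrow> 'a::euclidean_space" and g :: "real \<Rightarrow> 'b::euclidean_space"
  shows "f \<in> Linf T \<Longrightarrow> g \<in> Linf T \<Longrightarrow> (\<lambda>t. (f t, g t)) \<in> Linf T"
proof (erule Linf_combine[where K = "(+)"], assumption)
  show "norm (a, b) \<le> A + B" if "norm a \<le> A" "norm b \<le> B" for a :: 'a and b :: 'b and A B
    using norm_Pair_le[of a b] that by linarith
qed measurable

lemma Linf_inner:
  fixes f g :: "real \<Rightarrow> 'a::euclidean_space"
  shows "f \<in> Linf T \<Longrightarrow> g \<in> Linf T \<Longrightarrow> (\<lambda>t. f t \<bullet> g t) \<in> Linf T"
proof (erule Linf_combine[where K = "(*)"], assumption)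
  show "norm (a \<bullet> b) \<le> A * B" if "norm a \<le> A" "norm b \<le> B" for a b :: 'a and A B
  proof -
    have "norm a * norm b \<le> A * B"
      using that by (intro mult_mono order_trans[OF norm_ge_zero that(1)]) auto
    then show ?thesis
      using Cauchy_Schwarz_ineq2[of a b] by simp
  qed
qed measurable

lemma Linf_max:
  fixes f g :: "real \<Rightarrow> real"
  shows "f \<in> Linf T \<Longrightarrow> g \<in> Linf T \<Longrightarrow> (\<lambda>t. max (f t) (g t)) \<in> Linf T"
  by (erule Linf_combine[where K = max], assumption) (measurable, auto)

lemma Linf_zero: "(\<lambda>t. 0) \<in> Linf T"
  by (rule Linf_I[where C = 0]) auto

lemma Linf_minus: "f \<in> Linf T \<Longrightarrow> (\<lambda>t. - f t) \<in> Linf T"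
  using Linf_diff[OF Linf_zero] by simp

lemma Linf_abs:
  fixes f :: "real \<Rightarrow> real"
  assumes "f \<in> Linf T"
  shows "(\<lambda>t. \<bar>f t\<bar>) \<in> Linf T"
proof -
  have "(\<lambda>t. \<bar>f t\<bar>) = (\<lambda>t. max (f t) (- f t))" by auto
  then show ?thesis using Linf_max[OF assms Linf_minus[OF assms]] by simp
qed

text \<open>A component is the inner product with the basis vector \<open>axis i 1\<close>, so
  \<open>Linf_inner\<close> applies.\<close>

lemma Linf_nth:
  fixes f :: "real \<Rightarrow> real ^ 'n"
  assumes "f \<in> Linf T"
  shows "(\<lambda>t. f t $ i) \<in> Linf T"
proof -
  have "(\<lambda>t. axis i 1 :: real ^ 'n) \<in> Linf T"
    by (rule Linf_I[where C = "norm (axis i 1 :: real ^ 'n)"]) auto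
  from Linf_inner[OF assms this] show ?thesis by (simp add: inner_axis)
qed

lemma Linf_imp_integrable:
  assumes "f \<in> Linf T"
  shows "integrable (time_measure T) f"
  using assms
proof (rule Linf_E)
  fix C
  assume "f \<in> borel_measurable (time_measure T)" "AE t in time_measure T. norm (f t) \<le> C"
  then show ?thesis
    by (intro finite_measure.integrable_const_bound finite_measure_lebesgue_on) auto
qed

lemmas Linf_intros =
  Linf_add Linf_diff Linf_inner Linf_Pair Linf_max Linf_zero Linf_minus Linf_abs Linf_nth

text \<open>\<open>W1inf\<close> bounds only the derivative explicitly; the state is bounded as a
  continuous function on a compact interval.\<close>

lemma W1inf_imp_Linf:
  assumes "x \<in> W1inf T"
  shows "x \<in> Linf T"
proof -
  have cont: "continuous_on {0..T} x"
    using assms by (simp add: W1inf_def abs_cont_on_imp_continuous_on)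
  then have "bounded (x ` {0..T})"
    by (intro compact_imp_bounded compact_continuous_image) auto
  then obtain C where "\<And>t. t \<in> {0..T} \<Longrightarrow> norm (x t) \<le> C"
    unfolding bounded_iff by blast
  moreover have "x \<in> borel_measurable (time_measure T)"
    using cont by (rule continuous_imp_measurable_on_sets_lebesgue) simp
  ultimately show ?thesis
    by (intro Linf_I[where C = C]) (auto intro!: AE_I2 simp: space_restrict_space)
qed

lemma space_X_Linf:
  assumes "z \<in> space_X T"
  shows "fst z \<in> Linf T" "snd z \<in> Linf T" "wderiv T (fst z) \<in> Linf T" "at_time z \<in> Linf T"
proof -
  show *: "fst z \<in> Linf T" "snd z \<in> Linf T" "wderiv T (fst z) \<in> Linf T"
    using assms by (auto simp: space_X_def W1inf_imp_Linf) (auto simp: W1inf_def)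
  have "at_time z = (\<lambda>t. (fst z t, snd z t))"
    by (simp add: at_time_def fun_eq_iff)
  then show "at_time z \<in> Linf T"
    using Linf_Pair[OF *(1,2)] by simp
qed


section \<open>Majorization\<close>

lemma subdifferentialD:
  "v \<in> subdifferential f y \<Longrightarrow> v \<bullet> (w - y) \<le> f w - f y"
  unfolding subdifferential_def by (auto dest: spec[of _ w])

text \<open>This is what makes the penalty function monotone in the parameter, so that the lower
  bound for \<open>c 0\<close> serves all later parameters.\<close>

lemma penalty_term_nonneg: "0 \<le> penalty_term P z"
  unfolding penalty_term_def Let_def
  by (intro add_nonneg_nonneg sum_nonneg integral_nonneg) auto

text \<open>At the base point the linear terms vanish and the two branches of each equality maximum
  become plus and minus the residual. Hence the majorant is tight there for any
  subgradients.\<close>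

lemma Gamma_maj_at_base: "Gamma_maj P zb S zb = penalty_term P zb"
proof -
  have "max (a + b - c - 0) (- a + c - b - 0) = \<bar>a - (c - b)\<bar>" for a b c :: real
    by (auto simp: max_def abs_if)
  moreover have "max (a - b) (b - a) = \<bar>a - b\<bar>" for a b :: real
    by (auto simp: max_def abs_if)
  ultimately show ?thesis
    unfolding Gamma_maj_def penalty_term_def Let_def by simp
qed

section \<open>Essential bounds for the data and subgradients along trajectories\<close>

context dc_ocp_data
begin

lemma running_functions_mem:
  "cost_G P \<in> running_functions P" "cost_H P \<in> running_functions P"
  "(\<lambda>a t. dyn_G P a t $ i) \<in> running_functions P"
  "(\<lambda>a t. dyn_H P a t $ i) \<in> running_functions P"
  "s \<in> idx_M P \<Longrightarrow> path_p P s \<in> running_functions P"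
  "s \<in> idx_M P \<Longrightarrow> path_q P s \<in> running_functions P"
  unfolding running_functions_def by auto

text \<open>A trajectory in X stays in a fixed ball for almost every time, so the local bound
  \<open>running_bound\<close> for that ball holds along it.\<close>

lemma running_bound_along:
  assumes z: "z \<in> space_X (horizon P)"
  obtains \<gamma> where "AE t in time_measure (horizon P). \<forall>f\<in>running_functions P.
    \<bar>f (at_time z t) t\<bar> \<le> \<gamma> \<and> (\<forall>v\<in>subdifferential (\<lambda>y. f y t) (at_time z t). norm v \<le> \<gamma>)"
proof -
  let ?M = "time_measure (horizon P)"
  obtain A where A: "AE t in ?M. norm (fst z t) \<le> A"
    using space_X_Linf(1)[OF z] by (rule Linf_E)
  obtain B where B: "AE t in ?M. norm (snd z t) \<le> B"
    using space_X_Linf(2)[OF z] by (rule Linf_E)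
  \<comment> \<open>The absolute values and the added 1 make the radius positive whatever the signs
    of the essential bounds \<open>A\<close> and \<open>B\<close>.\<close>
  have "\<bar>A\<bar> + \<bar>B\<bar> + 1 > 0" by simp
  from running_bound[OF this] obtain \<gamma> where "AE t in ?M.
      \<forall>x u. norm x + norm u \<le> \<bar>A\<bar> + \<bar>B\<bar> + 1 \<longrightarrow>
           (\<forall>f\<in>running_functions P. \<bar>f (x, u) t\<bar> \<le> \<gamma> \<and>
             (\<forall>v\<in>subdifferential (\<lambda>y. f y t) (x, u). norm v \<le> \<gamma>))" by blast
  with A B have "AE t in ?M. \<forall>f\<in>running_functions P.
    \<bar>f (at_time z t) t\<bar> \<le> \<gamma> \<and> (\<forall>v\<in>subdifferential (\<lambda>y. f y t) (at_time z t). norm v \<le> \<gamma>)"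
  proof eventually_elim
    case (elim t)
    then have "norm (fst z t) + norm (snd z t) \<le> \<bar>A\<bar> + \<bar>B\<bar> + 1" by linarith
    with elim(3) show ?case unfolding at_time_def by blast
  qed
  then show ?thesis by (rule that)
qed

lemma running_Linf:
  assumes f: "f \<in> running_functions P" and z: "z \<in> space_X (horizon P)"
  shows "(\<lambda>t. f (at_time z t) t) \<in> Linf (horizon P)"
proof -
  let ?M = "time_measure (horizon P)"
  obtain \<gamma> where "AE t in ?M. \<forall>f\<in>running_functions P. \<bar>f (at_time z t) t\<bar> \<le> \<gamma> \<and>
      (\<forall>v\<in>subdifferential (\<lambda>y. f y t) (at_time z t). norm v \<le> \<gamma>)"
    by (rule running_bound_along[OF z])
  then have bound: "AE t in ?M. norm (f (at_time z t) t) \<le> \<gamma>"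
    by eventually_elim (use f in auto)
  have "(\<lambda>t. f (at_time z t) t) \<in> borel_measurable ?M"
  proof (rule borel_measurable_superposition[where f = f and y = "at_time z"])
    \<comment> \<open>The superposition lemma asks for continuity at every time, while
      \<open>caratheodory\<close> grants it almost everywhere; a finite convex function on a
      Euclidean space is continuous, which covers every time.\<close>
    show "continuous_on UNIV (\<lambda>y. f y t)" if "t \<in> space ?M" for t
      using running_convex[OF f] that
      by (intro convex_on_continuous) (auto simp: space_restrict_space)
    show "(\<lambda>t. f y t) \<in> borel_measurable ?M" for y
      using running_caratheodory[OF f] unfolding caratheodory_def by blast
    show "at_time z \<in> borel_measurable ?M"
      using space_X_Linf(4)[OF z] by (rule Linf_E)
  qed
  then show ?thesis using bound by (rule Linf_I)
qed

lemma measurable_subgradient_Linf: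
  assumes f: "f \<in> running_functions P" and z: "z \<in> space_X (horizon P)"
    and S: "measurable_subgradient (horizon P) f (at_time z) S"
  shows "S \<in> Linf (horizon P)"
proof -
  obtain \<gamma> where "AE t in time_measure (horizon P).
      \<forall>f\<in>running_functions P. \<bar>f (at_time z t) t\<bar> \<le> \<gamma> \<and>
      (\<forall>v\<in>subdifferential (\<lambda>y. f y t) (at_time z t). norm v \<le> \<gamma>)"
    by (rule running_bound_along[OF z])
  moreover have "AE t in time_measure (horizon P). S t \<in> subdifferential (\<lambda>a. f a t) (at_time z t)"
    using S by (simp add: measurable_subgradient_def)
  ultimately have "AE t in time_measure (horizon P). norm (S t) \<le> \<gamma>"
    by eventually_elim (use f in auto)
  then show ?thesis
    using S by (intro Linf_I) (auto simp: measurable_subgradient_def)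
qed

section \<open>Comparison with the majorants for a fixed base point \<open>zb\<close> and competitor
  \<open>w\<close>\<close>

context
  fixes zb w :: "('n, 'm) traj" and S :: "('n, 'm) subgrads"
  assumes zb: "zb \<in> space_X (horizon P)" and w: "w \<in> space_X (horizon P)"
    and S: "subgradients_at P zb S"
begin

lemma subgradients_measurable:
  "measurable_subgradient (horizon P) (cost_H P) (at_time zb) (sg_V0 S)"
  "measurable_subgradient (horizon P) (\<lambda>a t. dyn_H P a t $ i) (at_time zb) (sg_V S i)"
  "measurable_subgradient (horizon P) (\<lambda>a t. dyn_G P a t $ i) (at_time zb) (sg_W S i)"
  "s \<in> idx_M P \<Longrightarrow> measurable_subgradient (horizon P) (path_q P s) (at_time zb) (sg_z S s)"
  using S by (simp_all add: subgradients_at_def Let_def)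

lemma subgradients_ends:
  "i \<le> ell_E P \<Longrightarrow> sg_v S i \<in> subdifferential (end_h P i) (at_ends (horizon P) zb)"
  "i \<in> idx_E P \<Longrightarrow> sg_w S i \<in> subdifferential (end_g P i) (at_ends (horizon P) zb)"
  using S by (simp_all add: subgradients_at_def Let_def)

lemma subgradient_AE:
  assumes "measurable_subgradient (horizon P) f (at_time zb) s"
  shows "AE t in time_measure (horizon P).
    s t \<bullet> (at_time w t - at_time zb t) \<le> f (at_time w t) t - f (at_time zb t) t"
proof -
  have "AE t in time_measure (horizon P). s t \<in> subdifferential (\<lambda>a. f a t) (at_time zb t)"
    using assms by (simp add: measurable_subgradient_def)
  then show ?thesis by eventually_elim (rule subdifferentialD)
qed

lemmas subgradients_Linf =
  measurable_subgradient_Linf[OF running_functions_mem(2) zb subgradients_measurable(1)]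
  measurable_subgradient_Linf[OF running_functions_mem(4) zb subgradients_measurable(2)]
  measurable_subgradient_Linf[OF running_functions_mem(3) zb subgradients_measurable(3)]
  measurable_subgradient_Linf[OF running_functions_mem(6) zb subgradients_measurable(4)]

text \<open>All integrands below are built from these essentially bounded pieces by the closure
  rules, so their integrability follows by structural introduction.\<close>

lemmas Linf_data =
  Linf_intros subgradients_Linf space_X_Linf[OF zb] space_X_Linf[OF w]
  running_functions_mem(1-4)[THEN running_Linf, OF zb] running_functions_mem(1-4)[THEN running_Linf, OF w]
  running_functions_mem(5,6)[THEN running_Linf, OF _ zb] running_functions_mem(5,6)[THEN running_Linf, OF _ w]

text \<open>Each concave part lies below its linearization at \<open>zb\<close>, so every residual
  grows when the part entering with a minus sign is linearized. An absolute value is a maximum of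
  two opposite residuals; one sign linearizes H with \<open>sg_V\<close>, the other G with
  \<open>sg_W\<close>, and likewise \<open>sg_v\<close> and \<open>sg_w\<close> at the end
  points.\<close>

lemma penalty_term_le_Gamma_maj: "penalty_term P w \<le> Gamma_maj P zb S w"
proof -
  let ?M = "time_measure (horizon P)"
  let ?b = "at_ends (horizon P) w" and ?bb = "at_ends (horizon P) zb"
  have dyn: "(\<integral>t. \<bar>wderiv (horizon P) (fst w) t $ i
           - (dyn_G P (at_time w t) t $ i - dyn_H P (at_time w t) t $ i)\<bar> \<partial>?M)
    \<le> (\<integral>t. max
           (wderiv (horizon P) (fst w) t $ i + dyn_H P (at_time w t) t $ i
              - dyn_G P (at_time zb t) t $ i - sg_W S i t \<bullet> (at_time w t - at_time zb t))
           (- wderiv (horizon P) (fst w) t $ i + dyn_G P (at_time w t) t $ i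
              - dyn_H P (at_time zb t) t $ i - sg_V S i t \<bullet> (at_time w t - at_time zb t)) \<partial>?M)"
    for i
  proof (intro integral_mono_AE Linf_imp_integrable)
    show "AE t in ?M. \<bar>wderiv (horizon P) (fst w) t $ i
           - (dyn_G P (at_time w t) t $ i - dyn_H P (at_time w t) t $ i)\<bar>
      \<le> max
           (wderiv (horizon P) (fst w) t $ i + dyn_H P (at_time w t) t $ i
              - dyn_G P (at_time zb t) t $ i - sg_W S i t \<bullet> (at_time w t - at_time zb t))
           (- wderiv (horizon P) (fst w) t $ i + dyn_G P (at_time w t) t $ i
              - dyn_H P (at_time zb t) t $ i - sg_V S i t \<bullet> (at_time w t - at_time zb t))"
      using subgradient_AE[OF subgradients_measurable(2)[of i]]
        subgradient_AE[OF subgradients_measurable(3)[of i]]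
      by eventually_elim linarith
  qed (intro Linf_data)+
  \<comment> \<open>Subgradients of \<open>end_h\<close> are given for indices up to
    \<open>ell_E P\<close>; \<open>ell_I_le_ell_E\<close> brings the inequality indices into that
    range.\<close>
  have ineq: "max 0 (end_g P i ?b - end_h P i ?b)
      \<le> max 0 (end_g P i ?b - end_h P i ?bb - sg_v S i \<bullet> (?b - ?bb))" if "i \<in> idx_I P" for i
    using subdifferentialD[OF subgradients_ends(1), of i ?b] that ell_I_le_ell_E by auto
  have eq: "\<bar>end_g P i ?b - end_h P i ?b\<bar>
      \<le> max (end_g P i ?b - end_h P i ?bb - sg_v S i \<bullet> (?b - ?bb))
          (end_h P i ?b - end_g P i ?bb - sg_w S i \<bullet> (?b - ?bb))" if "i \<in> idx_E P" for i
    using subdifferentialD[OF subgradients_ends(1), of i ?b]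
      subdifferentialD[OF subgradients_ends(2), of i ?b] that by auto
  have path: "(\<integral>t. max 0 (path_p P s (at_time w t) t - path_q P s (at_time w t) t) \<partial>?M)
    \<le> (\<integral>t. max 0 (path_p P s (at_time w t) t - path_q P s (at_time zb t) t
          - sg_z S s t \<bullet> (at_time w t - at_time zb t)) \<partial>?M)"
    if s: "s \<in> idx_M P" for s
  proof (intro integral_mono_AE Linf_imp_integrable)
    show "AE t in ?M. max 0 (path_p P s (at_time w t) t - path_q P s (at_time w t) t)
      \<le> max 0 (path_p P s (at_time w t) t - path_q P s (at_time zb t) t
          - sg_z S s t \<bullet> (at_time w t - at_time zb t))"
      using subgradient_AE[OF subgradients_measurable(4)[OF s]] by eventually_elim auto
  qed (intro Linf_data s)+
  show ?thesis
    unfolding penalty_term_def Gamma_maj_def Let_def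
    by (intro add_mono sum_mono dyn ineq eq path)
qed

text \<open>The function \<open>omega_maj\<close> omits the constants of the linearization at
  \<open>zb\<close>, so it majorizes the cost only up to a constant. In differences this constant
  cancels, the G terms agree on both sides, and the subgradient inequality for H remains.\<close>

lemma cost_J_diff_le_omega_maj_diff:
  "cost_J P w - cost_J P zb \<le> omega_maj P S w - omega_maj P S zb"
proof -
  let ?M = "time_measure (horizon P)"
  let ?b = "at_ends (horizon P) w" and ?bb = "at_ends (horizon P) zb"
  let ?f = "\<lambda>z t. cost_G P (at_time z t) t - cost_H P (at_time z t) t"
  let ?g = "\<lambda>z t. cost_G P (at_time z t) t - sg_V0 S t \<bullet> at_time z t"
  have int: "integrable ?M (?f w)" "integrable ?M (?f zb)" "integrable ?M (?g w)" "integrable ?M (?g zb)"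
    by (intro Linf_imp_integrable Linf_data)+
  have "(\<integral>t. ?f w t - ?f zb t \<partial>?M) \<le> (\<integral>t. ?g w t - ?g zb t \<partial>?M)"
  proof (rule integral_mono_AE)
    show "integrable ?M (\<lambda>t. ?f w t - ?f zb t)"
      using int(1,2) by (rule Bochner_Integration.integrable_diff)
    show "integrable ?M (\<lambda>t. ?g w t - ?g zb t)"
      using int(3,4) by (rule Bochner_Integration.integrable_diff)
    show "AE t in ?M. ?f w t - ?f zb t \<le> ?g w t - ?g zb t"
      using subgradient_AE[OF subgradients_measurable(1)]
      by eventually_elim (simp add: inner_diff_right)
  qed
  then have "integral\<^sup>L ?M (?f w) - integral\<^sup>L ?M (?f zb)
      \<le> integral\<^sup>L ?M (?g w) - integral\<^sup>L ?M (?g zb)"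
    by (simp only: Bochner_Integration.integral_diff[OF int(1,2)]
        Bochner_Integration.integral_diff[OF int(3,4)])
  moreover have "sg_v S 0 \<bullet> (?b - ?bb) \<le> end_h P 0 ?b - end_h P 0 ?bb"
    by (intro subdifferentialD subgradients_ends) simp
  ultimately show ?thesis
    unfolding cost_J_def omega_maj_def by (simp add: inner_diff_right)
qed

text \<open>The majorization of the penalty term is scaled by \<open>c\<close> and becomes a
  statement about differences because it is tight at \<open>zb\<close>.\<close>

lemma penalty_fun_diff_le_Q_maj_diff:
  assumes "0 \<le> c"
  shows "penalty_fun P c w - penalty_fun P c zb
    \<le> Q_maj P c zb S w - Q_maj P c zb S zb"
  using cost_J_diff_le_omega_maj_diff mult_left_mono[OF penalty_term_le_Gamma_maj assms]
  unfolding penalty_fun_def Q_maj_def Gamma_maj_at_base by linarith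

end

end


section \<open>Convergence\<close>

text \<open>With positive \<kappa>, any number of increases moves the parameter at least as far as
  one.\<close>

lemma increase_until_cases:
  assumes "increase_until \<kappa> visited good a b" "0 < \<kappa>"
  shows "b = a \<or> a + \<kappa> \<le> b"
  using assms by induction auto

text \<open>The loop vouches only for newly visited parameters, so the starting one has to be
  supplied for the case of no increase.\<close>

lemma increase_until_computed:
  assumes "increase_until \<kappa> visited good a b" "visited a"
  shows "visited b"
  using assms by induction auto

text \<open>The sequence is monotone and bounded, hence Cauchy; once its increments are below
  \<kappa> they must be zero.\<close>

lemma bounded_jumps_eventually_const:
  fixes c :: "nat \<Rightarrow> real"
  assumes jump: "\<And>k. c (Suc k) = c k \<or> c k + \<kappa> \<le> c (Suc k)" and \<kappa>: "0 < \<kappa>"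
    and bounded: "bounded (range c)"
  obtains K where "\<And>k. K \<le> k \<Longrightarrow> c k = c K"
proof -
  have "incseq c"
  proof (intro incseq_SucI)
    show "c k \<le> c (Suc k)" for k
      using jump[of k] \<kappa> by linarith
  qed
  then have "convergent c"
    using bounded by (intro Bseq_monoseq_convergent) (auto simp: Bseq_eq_bounded monoseq_iff)
  then have "Cauchy c" by (rule convergent_Cauchy)
  then obtain K where K: "\<And>m n. K \<le> m \<Longrightarrow> K \<le> n \<Longrightarrow> dist (c m) (c n) < \<kappa>"
    using \<kappa> unfolding Cauchy_def by blast
  have "c k = c K" if "K \<le> k" for k
    using that
  proof (induction k rule: dec_induct)
    case (step k)
    then show ?case
      using K[of k "Suc k"] jump[of k] by (auto simp: dist_real_def)
  qed simp
  then show ?thesis by (rule that)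
qed

text \<open>Subtracting the partial sums of \<nu> from \<open>a\<close> gives a sequence
  \<open>b\<close> that truly decreases and stays bounded below. Its limit yields that of
  \<open>a\<close>, and telescoping its decrements bounds the partial sums of
  \<open>s\<close>.\<close>

lemma quasi_descent_convergent:
  fixes a s \<nu> :: "nat \<Rightarrow> real"
  assumes descent: "\<And>k. a (Suc k) \<le> a k - s k + \<nu> k"
    and s: "\<And>k. 0 \<le> s k" and lower: "\<And>k. B \<le> a k" and \<nu>: "summable \<nu>"
  shows "summable s" "convergent a"
proof -
  define b where "b k = a k - (\<Sum>i<k. \<nu> i)" for k
  have b_descent: "b (Suc k) \<le> b k - s k" for k
    using descent[of k] by (simp add: b_def)
  then have dec: "decseq b"
  proof (intro decseq_SucI)
    show "b (Suc k) \<le> b k" for k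
      using b_descent[of k] s[of k] by linarith
  qed
  from \<nu> have conv_sum: "convergent (\<lambda>k. \<Sum>i<k. \<nu> i)"
    by (simp add: summable_iff_convergent)
  then obtain N where N: "\<And>k. \<bar>\<Sum>i<k. \<nu> i\<bar> \<le> N"
    using convergent_imp_Bseq[of "\<lambda>k. \<Sum>i<k. \<nu> i"] unfolding Bseq_def real_norm_def by blast
  have low: "B - N \<le> b k" for k
    using lower[of k] N[of k] by (simp add: b_def)
  obtain l where "b \<longlonglongrightarrow> l"
    using decseq_convergent[OF dec] low by blast
  then have conv_b: "convergent b" by (auto simp: convergent_def)
  have "convergent (\<lambda>k. b k + (\<Sum>i<k. \<nu> i))"
    using conv_b conv_sum by (rule convergent_add)
  then show "convergent a" by (simp add: b_def)
  have "(\<Sum>i<k. s i) \<le> b 0 - b k" for k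
  proof (induction k)
    case (Suc k)
    then show ?case using b_descent[of k] by simp
  qed simp
  then have "(\<Sum>i<k. s i) \<le> b 0 - (B - N)" for k
    using low[of k] by (meson diff_left_mono order_trans)
  then show "summable s"
    using s by (intro summableI_nonneg_bounded)
qed

theorem theorem2:
  fixes P :: "('n::finite, 'm::finite) dc_ocp"
    and z :: "nat \<Rightarrow> ('n, 'm) traj"
    and sol :: "nat \<Rightarrow> real \<Rightarrow> ('n, 'm) traj"
    and zhat :: "nat \<Rightarrow> ('n, 'm) traj"
    and V :: "nat \<Rightarrow> ('n, 'm) subgrads"
    and c cplus \<epsilon> \<nu> abar \<alpha> \<rho> :: "nat \<Rightarrow> real"
    and j :: "nat \<Rightarrow> nat"
    and \<eta>1 \<eta>2 \<zeta> \<sigma> \<epsilon>\<phi> \<epsilon>feas \<kappa> :: real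
  assumes problem: "dc_ocp_data P"
    and parameters: "\<eta>1 \<in> {0<..<1}" "\<eta>2 \<in> {0<..<1}" "\<zeta> \<in> {0<..<1}" "\<sigma> \<in> {0<..<1}"
      "0 < \<epsilon>\<phi>" "0 < \<epsilon>feas" "\<And>k. 0 < \<epsilon> k" "0 < \<kappa>"
    and init: "z 0 \<in> adm P" "0 < c 0"
    and subgradients: "\<And>k. subgradients_at P (z k) (V k)"
    and steps_1_to_3:
      "\<And>k. steps_1_to_3 P \<kappa> \<eta>1 \<epsilon>\<phi> \<epsilon>feas (\<epsilon> k) (z k) (V k) (sol k) (zhat k) (c k) (cplus k)"
    and step_4: "\<And>k. step_4 P \<kappa> \<eta>2 (\<epsilon> k) (z k) (V k) (sol k) (cplus k) (c (Suc k))"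
    and step_5:
      "\<And>k. step_5 P \<zeta> \<sigma> (\<nu> k) (abar k) (j k) (c (Suc k)) (z k) (sol k (c (Suc k))) (z (Suc k))"
    and step_size: "\<And>k. \<alpha> k = \<zeta> ^ j k * abar k"
    and rho: "\<And>k. \<rho> k = norm_L2 (horizon P) (traj_diff (sol k (c (Suc k))) (z k))"
    and penalty_bounded_below: "bdd_below (penalty_fun P (c 0) ` adm P)"
    and c_bounded: "bounded (range c)"
    and nu_summable: "summable \<nu>"
  shows "summable (\<lambda>k. (\<alpha> k)\<^sup>2 * (\<rho> k)\<^sup>2)
    \<and> (\<lambda>k. \<bar>penalty_fun P (c (Suc k)) (z (Suc k)) - penalty_fun P (c (Suc k)) (z k)\<bar>)
          \<longlonglongrightarrow> 0
    \<and> convergent (\<lambda>k. penalty_fun P (c k) (z k))"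
proof -
  interpret dc_ocp_data P by (rule problem)
  define w where "w k = sol k (c (Suc k))" for k
  define \<Phi> where "\<Phi> k a = penalty_fun P (c k) a" for k a
  have comp_ck: "computed_point P (\<epsilon> k) (z k) (V k) (sol k) (c k)" for k
    using steps_1_to_3[of k] by (simp add: steps_1_to_3_def Let_def)
  \<comment> \<open>Steps 2 and 3 run the same loop with different tests. Only the size of the
    increases and the computed points matter, so the test is hidden behind an existential
    quantifier.\<close>
  have cplus_cases: "cplus k = c k \<or> (\<exists>good. increase_until \<kappa>
      (computed_point P (\<epsilon> k) (z k) (V k) (sol k)) good (c k) (cplus k))" for k
    using steps_1_to_3[of k] by (auto simp: steps_1_to_3_def Let_def split: if_splits)
  have comp_next: "computed_point P (\<epsilon> k) (z k) (V k) (sol k) (c (Suc k))" for k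
  proof -
    have "computed_point P (\<epsilon> k) (z k) (V k) (sol k) (cplus k)"
      using cplus_cases[of k] comp_ck[of k] increase_until_computed by metis
    with step_4[of k] show ?thesis
      unfolding step_4_def by (rule increase_until_computed)
  qed
  have jump: "c (Suc k) = c k \<or> c k + \<kappa> \<le> c (Suc k)" for k
  proof -
    have "cplus k = c k \<or> c k + \<kappa> \<le> cplus k"
      using cplus_cases[of k] increase_until_cases[OF _ \<open>0 < \<kappa>\<close>] by blast
    moreover have "c (Suc k) = cplus k \<or> cplus k + \<kappa> \<le> c (Suc k)"
      using step_4[of k] increase_until_cases[OF _ \<open>0 < \<kappa>\<close>] unfolding step_4_def by blast
    ultimately show ?thesis using \<open>0 < \<kappa>\<close> by linarith
  qed
  have c_ge: "c 0 \<le> c k" for k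
  proof (induction k)
    case (Suc k)
    then show ?case using jump[of k] \<open>0 < \<kappa>\<close> by linarith
  qed simp
  obtain K where K: "\<And>k. K \<le> k \<Longrightarrow> c k = c K"
    using bounded_jumps_eventually_const[OF jump \<open>0 < \<kappa>\<close> c_bounded] by blast

  have z_adm: "z k \<in> adm P" for k
  proof (cases k)
    case (Suc i)
    then show ?thesis using step_5[of i] by (simp add: step_5_def Let_def)
  qed (simp add: init)
  have w_adm: "w k \<in> adm P" for k
    using comp_next[of k] by (simp add: w_def computed_point_def eps_optimal_def)
  have descent: "\<Phi> (Suc k) (z (Suc k)) \<le> \<Phi> (Suc k) (z k) - \<sigma> * ((\<alpha> k)\<^sup>2 * (\<rho> k)\<^sup>2) + \<nu> k" for k
  proof -
    have "\<Phi> (Suc k) (w k) - \<Phi> (Suc k) (z k)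
        \<le> Q_maj P (c (Suc k)) (z k) (V k) (w k) - Q_maj P (c (Suc k)) (z k) (V k) (z k)"
      unfolding \<Phi>_def using z_adm w_adm adm_subset subgradients c_ge[of "Suc k"] \<open>0 < c 0\<close>
      by (intro penalty_fun_diff_le_Q_maj_diff) auto
    \<comment> \<open>This is the standing assumption on computed points, available for the final
      parameter by \<open>comp_next\<close>.\<close>
    also have "\<dots> \<le> 0"
      using comp_next[of k] by (simp add: computed_point_def w_def)
    finally have "\<Phi> (Suc k) (w k) \<le> \<Phi> (Suc k) (z k)" by simp
    moreover have "\<Phi> (Suc k) (z (Suc k)) - \<Phi> (Suc k) (w k) \<le> - \<sigma> * ((\<alpha> k)\<^sup>2 * (\<rho> k)\<^sup>2) + \<nu> k"
      using step_5[of k]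
      by (simp add: step_5_def Let_def line_search_accepts_def step_size rho w_def \<Phi>_def mult.assoc)
    ultimately show ?thesis by simp
  qed

  obtain B where B: "\<And>a. a \<in> adm P \<Longrightarrow> B \<le> penalty_fun P (c 0) a"
    using penalty_bounded_below unfolding bdd_below_def by blast
  have lower: "B \<le> \<Phi> k (z k)" for k
    using B[OF z_adm[of k]] mult_right_mono[OF c_ge[of k] penalty_term_nonneg[of P "z k"]]
    unfolding \<Phi>_def penalty_fun_def by linarith
  \<comment> \<open>The descent inequality at step k uses the parameter \<open>c (Suc k)\<close> on
    both sides; from \<open>K\<close> on this equals \<open>c k\<close>, so consecutive inequalities
    can be chained.\<close>
  have eq: "\<Phi> (Suc (k + K)) a = \<Phi> (k + K) a" for k a
    unfolding \<Phi>_def by (simp add: K[of "Suc (k + K)"] K[of "k + K"])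
  have "\<Phi> (Suc k + K) (z (Suc k + K)) \<le> \<Phi> (k + K) (z (k + K))
      - \<sigma> * ((\<alpha> (k + K))\<^sup>2 * (\<rho> (k + K))\<^sup>2) + \<nu> (k + K)" for k
    using descent[of "k + K"] by (simp add: eq)
  then have summ: "summable (\<lambda>k. \<sigma> * ((\<alpha> (k + K))\<^sup>2 * (\<rho> (k + K))\<^sup>2))"
    and conv: "convergent (\<lambda>k. \<Phi> (k + K) (z (k + K)))"
    using parameters(4) lower nu_summable
    by (intro quasi_descent_convergent[where a = "\<lambda>k. \<Phi> (k + K) (z (k + K))" and B = B
          and \<nu> = "\<lambda>k. \<nu> (k + K)" and s = "\<lambda>k. \<sigma> * ((\<alpha> (k + K))\<^sup>2 * (\<rho> (k + K))\<^sup>2)"];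
        simp add: summable_iff_shift)+
  \<comment> \<open>The factor \<sigma> is nonzero and can be removed; the first \<open>K\<close>
    terms do not affect summability.\<close>
  have "summable (\<lambda>k. (\<alpha> (k + K))\<^sup>2 * (\<rho> (k + K))\<^sup>2)"
    using summ parameters(4) by (subst (asm) summable_cmult_iff) auto
  then have 1: "summable (\<lambda>k. (\<alpha> k)\<^sup>2 * (\<rho> k)\<^sup>2)"
    by (rule summable_iff_shift[THEN iffD1])
  obtain L where L: "(\<lambda>k. \<Phi> (k + K) (z (k + K))) \<longlonglongrightarrow> L"
    using conv by (auto simp: convergent_def)
  then have lim: "(\<lambda>k. \<Phi> k (z k)) \<longlonglongrightarrow> L"
    by (rule LIMSEQ_offset)
  then have 3: "convergent (\<lambda>k. \<Phi> k (z k))"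
    by (auto simp: convergent_def)
  have "(\<lambda>k. \<Phi> (Suc k) (z (Suc k)) - \<Phi> k (z k)) \<longlonglongrightarrow> L - L"
    using LIMSEQ_Suc[OF lim] lim by (rule tendsto_diff)
  then have "(\<lambda>k. \<bar>\<Phi> (Suc k) (z (Suc k)) - \<Phi> k (z k)\<bar>) \<longlonglongrightarrow> 0"
    by (simp add: tendsto_rabs_zero_iff)
  \<comment> \<open>The limit just obtained evaluates \<open>z k\<close> with the old parameter,
    whereas the second claim uses the new one. Both agree for all k from \<open>K\<close>
    on.\<close>
  moreover have "\<forall>\<^sub>F k in sequentially. \<bar>\<Phi> (Suc k) (z (Suc k)) - \<Phi> k (z k)\<bar>
      = \<bar>\<Phi> (Suc k) (z (Suc k)) - \<Phi> (Suc k) (z k)\<bar>"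
    unfolding eventually_sequentially
  proof (intro exI[of _ K] allI impI)
    fix k assume "K \<le> k"
    then have "c (Suc k) = c k" using K[of k] K[of "Suc k"] by simp
    then show "\<bar>\<Phi> (Suc k) (z (Suc k)) - \<Phi> k (z k)\<bar> = \<bar>\<Phi> (Suc k) (z (Suc k)) - \<Phi> (Suc k) (z k)\<bar>"
      by (simp add: \<Phi>_def)
  qed
  ultimately have 2: "(\<lambda>k. \<bar>\<Phi> (Suc k) (z (Suc k)) - \<Phi> (Suc k) (z k)\<bar>) \<longlonglongrightarrow> 0"
    by (rule Lim_transform_eventually)
  show ?thesis
    using 1 2 3 unfolding \<Phi>_def by blast
qed

end
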